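(* Let $X$ be a topological space and $Y\subseteq X$. Then the path fibration map $\pi:P(X,Y)\to X\times Y$ and the diagonal map $\Delta_Y:Y\to X\times Y$ have the same homotopy Švarc genus, and both coincide with the relative topological complexity of $(X,Y)$; that is, \[ TC(X,Y)=secat(\pi)=hsecat(\pi)=hsecat(\Delta_Y). \]
   Context: $P(X,Y)$ is the space, with the compact-open topology, of all paths $\gamma:[0,1]\to X$ with $\gamma(1)\in Y$; $\pi(\gamma)=(\gamma(0),\gamma(1))$; and $\Delta_Y(y)=(y,y)$. The Švarc genus $secat(f)$ of a continuous map $f:A\to B$ is the least $n\ge 0$ such that $B$ can be covered by open sets $V_0,\dots,V_n$ and for each $j$ there is a continuous map $s_j:V_j\to A$ with $f\circ s_j=i_j$, where $i_j:V_j\hookrightarrow B$ is the inclusion. The homotopy Švarc genus $hsecat(f)$ is defined in the same way with $f\circ s_j\simeq i_j$ (homotopic) in place of equality. Both are $\infty$ if no such $n$ exists. The relative topological complexity $TC(X,Y)$ is defined as the Švarc genus of the fibration $\pi:P(X,Y)\to X\times Y$. *)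

theory Defs
  imports "HOL-Analysis.Analysis" "HOL-Library.Extended_Nat"
begin

text \<open>A continuous map \<open>S \<rightarrow> X\<close> is represented by a HOL function that is \<^const>\<open>undefined\<close>
  outside \<open>topspace S\<close>, so that distinct points of the mapping space are distinct maps.\<close>

definition mapping_space :: "'a topology \<Rightarrow> 'b topology \<Rightarrow> ('a \<Rightarrow> 'b) set" where
  "mapping_space S X = {f \<in> extensional (topspace S). continuous_map S X f}"

definition compact_open_topology :: "'a topology \<Rightarrow> 'b topology \<Rightarrow> ('a \<Rightarrow> 'b) topology" where
  "compact_open_topology S X =
     topology_generated_by
       {{f \<in> mapping_space S X. f ` K \<subseteq> U} | K U. compactin S K \<and> openin X U}"

lemma topspace_compact_open_topology [simp]:
  "topspace (compact_open_topology S X) = mapping_space S X"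
proof -
  have "mapping_space S X = {f \<in> mapping_space S X. f ` {} \<subseteq> topspace X}"
    by simp
  then have "mapping_space S X \<in>
      {{f \<in> mapping_space S X. f ` K \<subseteq> U} | K U. compactin S K \<and> openin X U}"
    using compactin_empty openin_topspace by blast
  then show ?thesis
    unfolding compact_open_topology_def topology_generated_by_topspace by blast
qed

definition rel_path_space :: "'a topology \<Rightarrow> 'a set \<Rightarrow> (real \<Rightarrow> 'a) topology" where
  "rel_path_space X Y =
     subtopology (compact_open_topology (top_of_set {0..1}) X) {\<gamma>. \<gamma> 1 \<in> Y}"

definition path_ends :: "(real \<Rightarrow> 'a) \<Rightarrow> 'a \<times> 'a" where
  "path_ends \<gamma> = (\<gamma> 0, \<gamma> 1)"

definition diagonal_map :: "'a \<Rightarrow> 'a \<times> 'a" where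
  "diagonal_map y = (y, y)"

text \<open>In both definitions \<open>f\<close> is meant to be a continuous map from \<open>A\<close> to \<open>B\<close>.  The infimum of
  the empty set in \<^typ>\<open>enat\<close> is \<open>\<infinity>\<close>.\<close>

definition secat :: "'a topology \<Rightarrow> 'b topology \<Rightarrow> ('a \<Rightarrow> 'b) \<Rightarrow> enat" where
  "secat A B f = Inf {enat n | n.
     \<exists>V s. (\<Union>j\<le>n. V j) = topspace B \<and>
       (\<forall>j\<le>n. openin B (V j) \<and> continuous_map (subtopology B (V j)) A (s j) \<and>
               (\<forall>b\<in>V j. (f \<circ> s j) b = b))}"

definition hsecat :: "'a topology \<Rightarrow> 'b topology \<Rightarrow> ('a \<Rightarrow> 'b) \<Rightarrow> enat" where
  "hsecat A B f = Inf {enat n | n.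
     \<exists>V s. (\<Union>j\<le>n. V j) = topspace B \<and>
       (\<forall>j\<le>n. openin B (V j) \<and> continuous_map (subtopology B (V j)) A (s j) \<and>
               homotopic_with (\<lambda>_. True) (subtopology B (V j)) B (f \<circ> s j) id)}"

definition relative_TC :: "'a topology \<Rightarrow> 'a set \<Rightarrow> enat" where
  "relative_TC X Y = secat (rel_path_space X Y) (prod_topology X (subtopology X Y)) path_ends"

lemma continuous_map_compact_open_eval:
  assumes "t \<in> topspace S"
  shows "continuous_map (compact_open_topology S X) X (\<lambda>f. f t)"
  unfolding continuous_map_def
proof (intro conjI allI impI)
  show "(\<lambda>f. f t) \<in> topspace (compact_open_topology S X) \<rightarrow> topspace X"
    using assms by (auto simp: mapping_space_def continuous_map_def)
next
  fix U assume U: "openin X U"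
  have "compactin S {t}"
    using assms by simp
  then have "openin (compact_open_topology S X) {f \<in> mapping_space S X. f ` {t} \<subseteq> U}"
    unfolding compact_open_topology_def using U by (intro topology_generated_by_Basis) blast
  then show "openin (compact_open_topology S X)
      {f \<in> topspace (compact_open_topology S X). f t \<in> U}"
    by simp
qed

lemma continuous_map_path_ends:
  "continuous_map (rel_path_space X Y) (prod_topology X (subtopology X Y)) path_ends"
  unfolding path_ends_def rel_path_space_def
  by (intro continuous_map_pairedI continuous_map_into_subtopology
        continuous_map_from_subtopology continuous_map_compact_open_eval) auto

lemma continuous_map_diagonal_map:
  "continuous_map (subtopology X Y) (prod_topology X (subtopology X Y)) diagonal_map"
  unfolding diagonal_map_def
  by (intro continuous_map_pairedI continuous_map_into_subtopology
        continuous_map_from_subtopology) auto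

end

theory Submission
  imports Defs
begin

text \<open>
  All the invariants count the open sets \<open>V\<close> needed to cover \<open>X \<times> Y\<close>, subject to the existence of a
  lift of the inclusion \<open>V \<rightarrow> X \<times> Y\<close>: a strict lift through the path fibration \<open>\<pi>\<close>, a lift up to
  homotopy through \<open>\<pi>\<close>, or a lift up to homotopy through the diagonal.  Each of these conditions says
  the same thing about \<open>V\<close>, namely that the two coordinate projections \<open>V \<rightarrow> X\<close> and
  \<open>V \<rightarrow> Y \<subseteq> X\<close> are homotopic as maps into \<open>X\<close>.  More generally, for any continuous
  \<open>f : Z \<rightarrow> X \<times> Y\<close>, the existence of a lift of \<open>f\<close> of any of the three kinds is equivalent to
  \<open>fst \<circ> f \<simeq> snd \<circ> f : Z \<rightarrow> X\<close>.

  Lifts give this homotopy because it exists universally: the coordinates of the diagonal are equal,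
  and those of \<open>\<pi>\<close> are homotopic over the path space by the evaluation map \<open>(t, \<gamma>) \<mapsto> \<gamma>(t)\<close>,
  which is continuous since \<open>[0,1]\<close> is locally compact Hausdorff
  (\<open>continuous_map_compact_open_evaluation\<close>).  Having homotopic coordinates is inherited by
  precomposition with \<open>s\<close> and by passage to a homotopic map, so it descends from \<open>\<pi>\<close> or the diagonal
  to \<open>f\<close> (\<open>homotopic_coordinates_of_homotopy_lift\<close>).

  Conversely, a homotopy \<open>h\<close> from \<open>fst \<circ> f\<close> to \<open>snd \<circ> f\<close> attaches to each \<open>z\<close> the path
  \<open>t \<mapsto> h(t, z)\<close> with ends \<open>f(z)\<close>; by the tube lemma this path depends continuously on \<open>z\<close> in the
  compact-open topology (\<open>continuous_map_curry_compact_open\<close>), which is a strict lift through \<open>\<pi>\<close>.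
  The same homotopy, moving only the first coordinate, joins \<open>f\<close> to the diagonal of \<open>snd \<circ> f\<close>.
  Transitivity of homotopy between maps into \<open>X\<close> thus takes the place of the homotopy lifting
  property of \<open>\<pi>\<close>.
\<close>

section \<open>The exponential law for the compact-open topology\<close>

text \<open>
  If \<open>h\<close> sends \<open>K \<times> {z}\<close> into an open \<open>U\<close> with \<open>K\<close> compact, the tube lemma thickens \<open>z\<close> to an open
  \<open>V\<close> such that \<open>h\<close> still sends \<open>K \<times> V\<close> into \<open>U\<close>; this is exactly continuity with respect to the
  subbasic open sets.  The restriction is there because points of the mapping space are
  extensional functions.
\<close>

lemma continuous_map_curry_compact_open:
  assumes h: "continuous_map (prod_topology S Z) X h"
  shows "continuous_map Z (compact_open_topology S X) (\<lambda>z. restrict (\<lambda>t. h (t, z)) (topspace S))"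
    (is "continuous_map Z _ ?c")
proof -
  have c_in: "?c z \<in> mapping_space S X" if "z \<in> topspace Z" for z
  proof -
    have "continuous_map S X (\<lambda>t. h (t, z))"
      using continuous_map_compose [OF continuous_map_pairedI h, of S "\<lambda>t. t" "\<lambda>t. z"] that
      by (simp add: o_def)
    then have "continuous_map S X (?c z)"
      by (rule continuous_map_eq) simp
    then show ?thesis
      by (simp add: mapping_space_def)
  qed
  show ?thesis
    unfolding compact_open_topology_def
  proof (rule continuous_on_generated_topo)
    have "mapping_space S X =
        \<Union> {{f \<in> mapping_space S X. f ` K \<subseteq> U} | K U. compactin S K \<and> openin X U}"
      using topspace_compact_open_topology [of S X]
      unfolding compact_open_topology_def topology_generated_by_topspace by simp
    then show "?c ` topspace Z \<subseteq>
        \<Union> {{f \<in> mapping_space S X. f ` K \<subseteq> U} | K U. compactin S K \<and> openin X U}"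
      using c_in by blast
  next
    fix N assume "N \<in> {{f \<in> mapping_space S X. f ` K \<subseteq> U} | K U. compactin S K \<and> openin X U}"
    then obtain K U where N: "N = {f \<in> mapping_space S X. f ` K \<subseteq> U}"
      and K: "compactin S K" and U: "openin X U" by blast
    have KS: "K \<subseteq> topspace S"
      using K by (rule compactin_subset_topspace)
    let ?W = "{p \<in> topspace (prod_topology S Z). h p \<in> U}"
    have W: "openin (prod_topology S Z) ?W"
      using h U by (rule openin_continuous_map_preimage)
    show "openin Z (?c -` N \<inter> topspace Z)"
    proof (subst openin_subopen, intro ballI)
      fix z assume z: "z \<in> ?c -` N \<inter> topspace Z"
      then have "K \<times> {z} \<subseteq> ?W"
        using KS by (auto simp: N)
      then obtain V' V where V: "openin Z V" "K \<subseteq> V'" "z \<in> V" "V' \<times> V \<subseteq> ?W"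
        using tube_lemma_left [OF W K, of z] z by blast
      have "V \<subseteq> ?c -` N \<inter> topspace Z"
      proof
        fix y assume y: "y \<in> V"
        then have yZ: "y \<in> topspace Z"
          using V(1) openin_subset by blast
        have "h (t, y) \<in> U" if "t \<in> K" for t
          using V that y by blast
        then have "?c y ` K \<subseteq> U"
          using KS by auto
        with c_in [OF yZ] yZ show "y \<in> ?c -` N \<inter> topspace Z"
          by (simp add: N)
      qed
      with V show "\<exists>T. openin Z T \<and> z \<in> T \<and> T \<subseteq> ?c -` N \<inter> topspace Z"
        by blast
    qed
  qed
qed

text \<open>
  Near \<open>(t, \<gamma>)\<close>, a compact neighbourhood \<open>K\<close> of \<open>t\<close> that \<open>\<gamma>\<close> maps into \<open>U\<close> does two jobs: it
  bounds the motion of \<open>t\<close>, and it is the compact set of a subbasic neighbourhood of \<open>\<gamma>\<close>.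
\<close>

lemma continuous_map_compact_open_evaluation:
  assumes S: "neighbourhood_base_of (compactin S) S"
  shows "continuous_map (prod_topology S (compact_open_topology S X)) X (\<lambda>(t, \<gamma>). \<gamma> t)"
  unfolding continuous_map_def
proof (intro conjI allI impI)
  show "(\<lambda>(t, \<gamma>). \<gamma> t) \<in> topspace (prod_topology S (compact_open_topology S X)) \<rightarrow> topspace X"
    by (auto simp: mapping_space_def continuous_map_def)
next
  fix U assume U: "openin X U"
  let ?C = "compact_open_topology S X"
  let ?E = "{p \<in> topspace (prod_topology S ?C). (case p of (t, \<gamma>) \<Rightarrow> \<gamma> t) \<in> U}"
  show "openin (prod_topology S ?C) ?E"
  proof (subst openin_subopen, intro ballI)
    fix p assume "p \<in> ?E"
    then obtain t \<gamma> where p: "p = (t, \<gamma>)" and t: "t \<in> topspace S"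
      and \<gamma>: "\<gamma> \<in> mapping_space S X" and tU: "\<gamma> t \<in> U"
      by auto
    have "openin S {r \<in> topspace S. \<gamma> r \<in> U}"
      using \<gamma> U openin_continuous_map_preimage unfolding mapping_space_def by blast
    then obtain O' K where O': "openin S O'" "t \<in> O'" "O' \<subseteq> K"
      and K: "compactin S K" "K \<subseteq> {r \<in> topspace S. \<gamma> r \<in> U}"
      using S t tU unfolding neighbourhood_base_of
      by (metis (mono_tags, lifting) mem_Collect_eq)
    let ?N = "{f \<in> mapping_space S X. f ` K \<subseteq> U}"
    have "openin ?C ?N"
      unfolding compact_open_topology_def using U K by (intro topology_generated_by_Basis) blast
    then have "openin (prod_topology S ?C) (O' \<times> ?N)"
      using O' by (simp add: openin_prod_Times_iff)
    moreover have "p \<in> O' \<times> ?N"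
      using p O' K \<gamma> by auto
    moreover have "O' \<times> ?N \<subseteq> ?E"
      using O' openin_subset [OF O'(1)] by auto
    ultimately show "\<exists>T. openin (prod_topology S ?C) T \<and> p \<in> T \<and> T \<subseteq> ?E"
      by blast
  qed
qed

section \<open>Lifts and homotopies between the coordinates\<close>

abbreviation homotopic_maps :: "'a topology \<Rightarrow> 'b topology \<Rightarrow> ('a \<Rightarrow> 'b) \<Rightarrow> ('a \<Rightarrow> 'b) \<Rightarrow> bool" where
  "homotopic_maps \<equiv> homotopic_with (\<lambda>_. True)"

text \<open>
  The evaluation map is itself a homotopy between evaluation at \<open>0\<close> and evaluation at \<open>1\<close>.
\<close>

lemma homotopic_path_endpoints:
  "homotopic_maps (rel_path_space X Y) X (fst \<circ> path_ends) (snd \<circ> path_ends)"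
proof -
  let ?I = "top_of_set {0..1::real}"
  have "neighbourhood_base_of (compactin ?I) ?I"
  proof (subst locally_compact_space_neighbourhood_base [symmetric])
    show "Hausdorff_space ?I \<or> regular_space ?I"
      by (simp add: Hausdorff_space_subtopology)
    show "locally_compact_space ?I"
      by (intro compact_imp_locally_compact_space) (simp add: compact_space_subtopology)
  qed
  then have ev: "continuous_map (prod_topology ?I (compact_open_topology ?I X)) X (\<lambda>(t, \<gamma>). \<gamma> t)"
    by (rule continuous_map_compact_open_evaluation)
  have "continuous_map (prod_topology ?I (rel_path_space X Y)) X (\<lambda>(t, \<gamma>). \<gamma> t)"
    unfolding rel_path_space_def prod_topology_subtopology(2)
    using ev by (rule continuous_map_from_subtopology)
  then show ?thesis
    by (subst homotopic_with) (auto simp: path_ends_def intro!: exI)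
qed

text \<open>
  A homotopy \<open>h\<close> between the coordinates of \<open>f\<close>, read at a fixed \<open>z\<close> as a function of time, is a path
  joining the two coordinates of \<open>f(z)\<close>.  It runs through \<open>X\<close> and meets \<open>Y\<close> at time \<open>1\<close> because
  \<open>snd (f z) \<in> Y\<close>.
\<close>

lemma strict_path_lift:
  assumes f: "continuous_map Z (prod_topology X (subtopology X Y)) f"
    and hom: "homotopic_maps Z X (fst \<circ> f) (snd \<circ> f)"
  shows "\<exists>s. continuous_map Z (rel_path_space X Y) s \<and> (\<forall>z\<in>topspace Z. (path_ends \<circ> s) z = f z)"
proof -
  let ?I = "top_of_set {0..1::real}"
  obtain h where h: "continuous_map (prod_topology ?I Z) X h"
    and h0: "\<And>z. z \<in> topspace Z \<Longrightarrow> h (0, z) = fst (f z)"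
    and h1: "\<And>z. z \<in> topspace Z \<Longrightarrow> h (1, z) = snd (f z)"
    using hom by (subst (asm) homotopic_with) auto
  define s where "s = (\<lambda>z. restrict (\<lambda>t. h (t, z)) (topspace ?I))"
  have ends: "path_ends (s z) = f z" if "z \<in> topspace Z" for z
    using that by (simp add: s_def path_ends_def h0 h1)
  have "continuous_map Z (compact_open_topology ?I X) s"
    unfolding s_def using h by (rule continuous_map_curry_compact_open)
  moreover have "s z 1 \<in> Y" if "z \<in> topspace Z" for z
  proof -
    have "snd (f z) \<in> Y"
      using f that by (force simp: continuous_map_def Pi_iff mem_Times_iff)
    then show ?thesis
      using ends [OF that] by (simp add: path_ends_def prod_eq_iff)
  qed
  ultimately have "continuous_map Z (rel_path_space X Y) s"
    unfolding rel_path_space_def by (auto simp: continuous_map_in_subtopology)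
  with ends show ?thesis by auto
qed

text \<open>
  Composing the homotopies \<open>fst \<circ> f \<simeq> fst \<circ> g \<circ> s \<simeq> snd \<circ> g \<circ> s \<simeq> snd \<circ> f\<close> in \<open>X\<close> gives the
  claim.  For \<open>g = \<pi>\<close> this amounts to prolonging the paths of a homotopy lift at both ends.
\<close>

lemma homotopic_coordinates_of_homotopy_lift:
  assumes g: "homotopic_maps A X (fst \<circ> g) (snd \<circ> g)"
    and s: "continuous_map Z A s"
    and gs: "homotopic_maps Z (prod_topology X (subtopology X Y)) (g \<circ> s) f"
  shows "homotopic_maps Z X (fst \<circ> f) (snd \<circ> f)"
proof -
  have snd: "continuous_map (prod_topology X (subtopology X Y)) X snd"
    using continuous_map_snd by (rule continuous_map_into_fulltopology)
  have "homotopic_maps Z X (fst \<circ> (g \<circ> s)) (fst \<circ> f)"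
    using gs by (rule homotopic_with_compose_continuous_map_left) (auto simp: continuous_map_fst)
  moreover have "homotopic_maps Z X (snd \<circ> (g \<circ> s)) (snd \<circ> f)"
    using gs by (rule homotopic_with_compose_continuous_map_left) (auto simp: snd)
  moreover have "homotopic_maps Z X (fst \<circ> (g \<circ> s)) (snd \<circ> (g \<circ> s))"
    using homotopic_with_compose_continuous_map_right [OF g s] by (simp add: o_assoc)
  ultimately show ?thesis
    by (meson homotopic_with_symD homotopic_with_trans)
qed

text \<open>
  Only the first coordinate, which may roam through all of \<open>X\<close>, has to be moved from \<open>snd \<circ> f\<close> to
  \<open>fst \<circ> f\<close>; keeping the second one fixed ensures that the homotopy never leaves \<open>X \<times> Y\<close>.
\<close>

lemma homotopy_diagonal_lift:
  assumes f: "continuous_map Z (prod_topology X (subtopology X Y)) f"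
    and hom: "homotopic_maps Z X (fst \<circ> f) (snd \<circ> f)"
  shows "homotopic_maps Z (prod_topology X (subtopology X Y)) (diagonal_map \<circ> (snd \<circ> f)) f"
proof -
  let ?I = "top_of_set {0..1::real}"
  obtain h where h: "continuous_map (prod_topology ?I Z) X h"
    and h0: "\<And>z. z \<in> topspace Z \<Longrightarrow> h (0, z) = snd (f z)"
    and h1: "\<And>z. z \<in> topspace Z \<Longrightarrow> h (1, z) = fst (f z)"
    using homotopic_with_symD [OF hom] by (subst (asm) homotopic_with) auto
  have "continuous_map (prod_topology ?I Z) (subtopology X Y) (snd \<circ> (f \<circ> snd))"
    using continuous_map_compose [OF continuous_map_compose [OF continuous_map_snd f] continuous_map_snd]
    by (simp only: o_assoc)
  then have "continuous_map (prod_topology ?I Z) (prod_topology X (subtopology X Y))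
      (\<lambda>p. (h p, snd (f (snd p))))"
    using h by (intro continuous_map_pairedI) (auto simp: o_def)
  then show ?thesis
    by (subst homotopic_with) (auto simp: diagonal_map_def h0 h1 intro!: exI)
qed

lemma homotopic_of_strict_lift:
  assumes g: "continuous_map A B g" and s: "continuous_map Z A s"
    and gs: "\<forall>z\<in>topspace Z. (g \<circ> s) z = f z"
  shows "homotopic_maps Z B (g \<circ> s) f"
  using continuous_map_compose [OF s g] gs by (intro homotopic_with_equal) auto

lemma strict_path_lift_iff_homotopic_coordinates:
  assumes f: "continuous_map Z (prod_topology X (subtopology X Y)) f"
  shows "(\<exists>s. continuous_map Z (rel_path_space X Y) s \<and> (\<forall>z\<in>topspace Z. (path_ends \<circ> s) z = f z))
    \<longleftrightarrow> homotopic_maps Z X (fst \<circ> f) (snd \<circ> f)"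
proof
  assume "\<exists>s. continuous_map Z (rel_path_space X Y) s \<and>
    (\<forall>z\<in>topspace Z. (path_ends \<circ> s) z = f z)"
  then obtain s where s: "continuous_map Z (rel_path_space X Y) s"
    and sf: "\<forall>z\<in>topspace Z. (path_ends \<circ> s) z = f z"
    by blast
  have "homotopic_maps Z (prod_topology X (subtopology X Y)) (path_ends \<circ> s) f"
    using continuous_map_path_ends s sf by (rule homotopic_of_strict_lift)
  then show "homotopic_maps Z X (fst \<circ> f) (snd \<circ> f)"
    by (rule homotopic_coordinates_of_homotopy_lift [OF homotopic_path_endpoints s])
qed (rule strict_path_lift [OF f])

lemma homotopy_path_lift_iff_homotopic_coordinates:
  assumes f: "continuous_map Z (prod_topology X (subtopology X Y)) f"
  shows "(\<exists>s. continuous_map Z (rel_path_space X Y) s \<and>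
      homotopic_maps Z (prod_topology X (subtopology X Y)) (path_ends \<circ> s) f)
    \<longleftrightarrow> homotopic_maps Z X (fst \<circ> f) (snd \<circ> f)"
proof
  assume "homotopic_maps Z X (fst \<circ> f) (snd \<circ> f)"
  then obtain s where s: "continuous_map Z (rel_path_space X Y) s"
    and sf: "\<forall>z\<in>topspace Z. (path_ends \<circ> s) z = f z"
    using strict_path_lift [OF f] by blast
  have "homotopic_maps Z (prod_topology X (subtopology X Y)) (path_ends \<circ> s) f"
    using continuous_map_path_ends s sf by (rule homotopic_of_strict_lift)
  with s show "\<exists>s. continuous_map Z (rel_path_space X Y) s \<and>
      homotopic_maps Z (prod_topology X (subtopology X Y)) (path_ends \<circ> s) f"
    by blast
qed (blast intro: homotopic_coordinates_of_homotopy_lift [OF homotopic_path_endpoints])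

lemma homotopy_diagonal_lift_iff_homotopic_coordinates:
  assumes f: "continuous_map Z (prod_topology X (subtopology X Y)) f"
  shows "(\<exists>s. continuous_map Z (subtopology X Y) s \<and>
      homotopic_maps Z (prod_topology X (subtopology X Y)) (diagonal_map \<circ> s) f)
    \<longleftrightarrow> homotopic_maps Z X (fst \<circ> f) (snd \<circ> f)"
proof
  have "homotopic_maps (subtopology X Y) X (fst \<circ> diagonal_map) (snd \<circ> diagonal_map)"
    by (rule homotopic_with_equal)
      (auto simp: diagonal_map_def o_def continuous_map_from_subtopology)
  then show "homotopic_maps Z X (fst \<circ> f) (snd \<circ> f)"
    if "\<exists>s. continuous_map Z (subtopology X Y) s \<and>
      homotopic_maps Z (prod_topology X (subtopology X Y)) (diagonal_map \<circ> s) f"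
    using that by (blast intro: homotopic_coordinates_of_homotopy_lift)
next
  assume "homotopic_maps Z X (fst \<circ> f) (snd \<circ> f)"
  moreover have "continuous_map Z (subtopology X Y) (snd \<circ> f)"
    using f continuous_map_snd by (rule continuous_map_compose)
  ultimately show "\<exists>s. continuous_map Z (subtopology X Y) s \<and>
      homotopic_maps Z (prod_topology X (subtopology X Y)) (diagonal_map \<circ> s) f"
    using homotopy_diagonal_lift [OF f] by blast
qed

section \<open>Covers by open sets with homotopic coordinate projections\<close>

text \<open>
  Both genera have this form, \<open>Q V\<close> being the existence of a lift over \<open>V\<close>.  Here the lifts are
  chosen separately over each member of the cover, so that genera can be compared by comparing
  the conditions on a single open set.  The members are \<open>V 0, \<dots>, V n\<close>, hence the value is one
  less than the number of sets.
\<close>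

definition open_cover_number :: "'b topology \<Rightarrow> ('b set \<Rightarrow> bool) \<Rightarrow> enat" where
  "open_cover_number B Q = Inf {enat n | n.
     \<exists>V. (\<Union>j\<le>n. V j) = topspace B \<and> (\<forall>j\<le>n. openin B (V j) \<and> Q (V j))}"

lemma open_cover_number_cong:
  assumes "\<And>V. openin B V \<Longrightarrow> Q V \<longleftrightarrow> R V"
  shows "open_cover_number B Q = open_cover_number B R"
  using assms unfolding open_cover_number_def by (simp cong: conj_cong)

lemma secat_eq_open_cover_number:
  "secat A B f = open_cover_number B
     (\<lambda>V. \<exists>s. continuous_map (subtopology B V) A s \<and> (\<forall>b\<in>V. (f \<circ> s) b = b))"
proof -
  have "(\<exists>s. \<forall>j\<le>n. openin B (V j) \<and> continuous_map (subtopology B (V j)) A (s j) \<and>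
               (\<forall>b\<in>V j. (f \<circ> s j) b = b))
    \<longleftrightarrow> (\<forall>j\<le>n. openin B (V j) \<and> (\<exists>s. continuous_map (subtopology B (V j)) A s \<and>
               (\<forall>b\<in>V j. (f \<circ> s) b = b)))" for n :: nat and V
    by metis
  then show ?thesis
    unfolding secat_def open_cover_number_def by simp
qed

lemma hsecat_eq_open_cover_number:
  "hsecat A B f = open_cover_number B
     (\<lambda>V. \<exists>s. continuous_map (subtopology B V) A s \<and> homotopic_maps (subtopology B V) B (f \<circ> s) id)"
proof -
  have "(\<exists>s. \<forall>j\<le>n. openin B (V j) \<and> continuous_map (subtopology B (V j)) A (s j) \<and>
               homotopic_maps (subtopology B (V j)) B (f \<circ> s j) id)
    \<longleftrightarrow> (\<forall>j\<le>n. openin B (V j) \<and> (\<exists>s. continuous_map (subtopology B (V j)) A s \<and>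
               homotopic_maps (subtopology B (V j)) B (f \<circ> s) id))" for n :: nat and V
    by metis
  then show ?thesis
    unfolding hsecat_def open_cover_number_def by simp
qed

theorem proposition3p2:
  fixes X :: "'a topology" and Y :: "'a set"
  assumes "Y \<subseteq> topspace X"
  shows "relative_TC X Y
           = secat (rel_path_space X Y) (prod_topology X (subtopology X Y)) path_ends \<and>
         secat (rel_path_space X Y) (prod_topology X (subtopology X Y)) path_ends
           = hsecat (rel_path_space X Y) (prod_topology X (subtopology X Y)) path_ends \<and>
         hsecat (rel_path_space X Y) (prod_topology X (subtopology X Y)) path_ends
           = hsecat (subtopology X Y) (prod_topology X (subtopology X Y)) diagonal_map"
proof -
  let ?B = "prod_topology X (subtopology X Y)"
  let ?Q = "\<lambda>V. homotopic_maps (subtopology ?B V) X (fst \<circ> id) (snd \<circ> id)"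
  have incl: "continuous_map (subtopology ?B V) ?B id" for V
    by (simp add: continuous_map_from_subtopology)
  have top: "topspace (subtopology ?B V) = V" if "openin ?B V" for V
    using openin_subset [OF that] by (rule topspace_subtopology_subset)
  have "secat (rel_path_space X Y) ?B path_ends = open_cover_number ?B ?Q"
    unfolding secat_eq_open_cover_number
  proof (rule open_cover_number_cong)
    fix V assume "openin ?B V"
    then show "(\<exists>s. continuous_map (subtopology ?B V) (rel_path_space X Y) s \<and>
        (\<forall>b\<in>V. (path_ends \<circ> s) b = b)) \<longleftrightarrow> ?Q V"
      using strict_path_lift_iff_homotopic_coordinates [OF incl [of V]] by (simp only: top id_apply)
  qed
  moreover have "hsecat (rel_path_space X Y) ?B path_ends = open_cover_number ?B ?Q"
    unfolding hsecat_eq_open_cover_number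
    by (intro open_cover_number_cong homotopy_path_lift_iff_homotopic_coordinates incl)
  moreover have "hsecat (subtopology X Y) ?B diagonal_map = open_cover_number ?B ?Q"
    unfolding hsecat_eq_open_cover_number
    by (intro open_cover_number_cong homotopy_diagonal_lift_iff_homotopic_coordinates incl)
  ultimately show ?thesis
    by (simp add: relative_TC_def)
qed

end
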